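(* For any pair of times $(t,m)$ and $(t',m')$, any multi-indices $\alpha_i^{(k)}\in[k]$, $\alpha_j^{(\ell)}\in[\ell]$, points $r_1\in\mathscr D^*_{\alpha_j^{(\ell)}}(t',m')$ and $r_2\in\mathscr D_{\alpha_i^{(k)}}(t,m)$ in the respective domains of convergence, and $D$-dimensional tori $\mathbb T^D(r_1)$ and $\mathbb T^D(r_2)$ (Shilov borders of polydisks), the Baker and adjoint Baker functions satisfy the bilinear identity $$\int_{\mathbb T^D(r_1)}(\Psi_1)_{\alpha_i^{(k)}}(z,t,m)\,(\Psi_1^* )_{\alpha_j^{(\ell)}}(z,t',m')\,dz_1\cdots dz_D=\int_{\mathbb T^D(r_2)}(\Psi_2)_{\alpha_i^{(k)}}(z,t,m)\,(\Psi_2^* )_{\alpha_j^{(\ell)}}(z,t',m')\,dz_1\cdots dz_D.$$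
   Context: Let $D\ge 1$. For $k\in\mathbb Z_+$ let $[k]=\{\alpha\in\mathbb Z_+^D:|\alpha|=k\}=\{\alpha^{(k)}_1,\alpha^{(k)}_2,\dots\}$, ordered so that $\alpha>\alpha'$ iff at the first coordinate where they differ the entry of $\alpha$ is smaller. $\chi_{[k]}(x)$ is the column vector of monomials $x^\alpha$, $\alpha\in[k]$, and $\chi$ stacks $\chi_{[0]},\chi_{[1]},\dots$; $\chi^*(z)=\big(\prod_az_a^{-1}\big)\chi(z_1^{-1},\dots,z_D^{-1})$. Semi-infinite matrices are partitioned in blocks indexed by $[k],[\ell]$. Shift matrices: $\Lambda_a$ has as only nonzero blocks $(\Lambda_a)_{[k],[k+1]}$, with entries $\delta_{\alpha+e_a,\alpha'}$, $\alpha\in[k]$, $\alpha'\in[k+1]$; $\Lambda_\alpha=\Lambda_1^{\alpha_1}\cdots\Lambda_D^{\alpha_D}$; $n\cdot\Lambda=\sum_an_a\Lambda_a$; $\Lambda_\alpha\chi=x^\alpha\chi$. Flows: fix an invertible $N=(n_{a,b})\in GL(\mathbb R^D)$ with rows $n_a$, and $q\in\mathbb R^D$ with all $q_a\ne0$. Let $\mu$ be a Borel measure with finite moments, supported in $\{x:|n_a\cdot x|<|q_a|\ \forall a\}$, and $G=\int\chi\,d\mu\,\chi^\top$. For real times $t=(t_\alpha)_{\alpha\in\mathbb Z_+^D}$ and $m\in\mathbb Z^D$ put $t(x)=\sum_\alpha t_\alpha x^\alpha$, $$W_0(t,m)=\exp\Big(\sum_\alpha t_\alpha\Lambda_\alpha\Big)\prod_{a=1}^D(n_a\cdot\Lambda-q_a)^{m_a},\qquad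 G(t,m)=W_0(t,m)G,$$ where for negative powers $(n_a\cdot\Lambda-q_a)^{-1}=-\sum_{j\ge0}q_a^{-j-1}(n_a\cdot\Lambda)^j$. $G(t,m)$ is the moment matrix of $d\mu_{t,m}=e^{t(x)}\prod_a(n_a\cdot x-q_a)^{m_a}d\mu(x)$. It is assumed that $G(t,m)=S^{-1}H(S^{-1})^\top$ with $S=S(t,m)$ block lower triangular with identity diagonal blocks and $H=H(t,m)$ block diagonal with invertible blocks. Put $P=S\chi$, $W_1=SW_0$, $W_2=H(S^{-1})^\top$; then $G=W_1^{-1}W_2$. Baker functions: $\Psi_1=W_1\chi$, i.e. $\Psi_1(z,t,m)=e^{t(z)}\prod_a(n_a\cdot z-q_a)^{m_a}P(z,t,m)$, and $\Psi_2=W_2\chi^*$; adjoint Baker functions: $\Psi_1^*=(W_1^{-1})^\top\chi^*=H^{-1}SG\chi^*$, $\Psi_2^*=(W_2^{-1})^\top\chi=H^{-1}P$. Entries are indexed by multi-indices. $\mathscr D_\alpha(t,m)\subset\mathbb C^D$ and $\mathscr D^*_\alpha(t,m)\subset\mathbb C^D$ are the domains of convergence of the Laurent series $(\Psi_2)_\alpha(z,t,m)$ and $(\Psi_1^* )_\alpha(z,t,m)$, respectively. For $r\in\mathbb R_{>0}^D$, $\mathbb T^D(r)=\{z\in\mathbb C^D:|z_i|=r_i,\ i=1,\dots,D\}$, each circle positively oriented.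
   Formalization: The formal statement also requires r_1 to lie in the domain of convergence of the power series (Ψ_1)_α(z,t,m)=(W_1χ)_α; without this the identity fails for negative m_a, when the torus encloses poles n_a·z=q_a of Ψ_1. *)

theory Defs
  imports "HOL-Analysis.Analysis"
begin

text \<open>
  Multi-indices in dimension \<open>D = CARD('d)\<close> are vectors of type \<open>nat ^ 'd\<close>; the layer \<open>[k]\<close> is the
  set of multi-indices of length \<open>k\<close>.  Semi-infinite matrices are indexed directly by
  multi-indices, so the order of the multi-indices inside a layer plays no role.
\<close>

type_synonym 'd semimat = "nat ^ 'd \<Rightarrow> nat ^ 'd \<Rightarrow> real"
type_synonym 'd flow_times = "nat ^ 'd \<Rightarrow> real"
type_synonym 'd discrete_times = "int ^ 'd"
type_synonym 'd rvec = "real ^ 'd"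
type_synonym 'd rmat = "real ^ 'd ^ 'd"
type_synonym 'd cvec = "complex ^ 'd"
type_synonym 'd mindex = "nat ^ 'd"

definition mdeg :: "nat ^ 'd::finite \<Rightarrow> nat" where
  "mdeg \<alpha> = (\<Sum>a\<in>UNIV. \<alpha> $ a)"

definition layer :: "nat \<Rightarrow> (nat ^ 'd::finite) set" where
  "layer k = {\<alpha>. mdeg \<alpha> = k}"

definition mpower :: "'a::comm_semiring_1 ^ 'd::finite \<Rightarrow> nat ^ 'd \<Rightarrow> 'a" where
  "mpower x \<alpha> = (\<Prod>a\<in>UNIV. (x $ a) ^ (\<alpha> $ a))"


subsection \<open>Block products of semi-infinite matrices\<close>

text \<open>
  The product of two matrices is the product of block matrices: the finite sums over the blocks
  \<open>[k]\<close> come first, followed by a series over \<open>k\<close>.  The relation \<open>has_mmul A B C\<close> says that all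
  these series converge and that the product is \<open>C\<close>.
\<close>

definition mmul :: "'d::finite semimat \<Rightarrow> 'd semimat \<Rightarrow> 'd semimat" (infixl "\<odot>" 70) where
  "A \<odot> B = (\<lambda>\<alpha> \<beta>. \<Sum>k. \<Sum>\<gamma>\<in>layer k. A \<alpha> \<gamma> * B \<gamma> \<beta>)"

definition has_mmul :: "'d::finite semimat \<Rightarrow> 'd semimat \<Rightarrow> 'd semimat \<Rightarrow> bool" where
  "has_mmul A B C \<longleftrightarrow> (\<forall>\<alpha> \<beta>. (\<lambda>k. \<Sum>\<gamma>\<in>layer k. A \<alpha> \<gamma> * B \<gamma> \<beta>) sums C \<alpha> \<beta>)"

definition mvec :: "'d::finite semimat \<Rightarrow> (nat ^ 'd \<Rightarrow> complex) \<Rightarrow> nat ^ 'd \<Rightarrow> complex" where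
  "mvec A v = (\<lambda>\<alpha>. \<Sum>k. \<Sum>\<gamma>\<in>layer k. of_real (A \<alpha> \<gamma>) * v \<gamma>)"

definition mone :: "'d::finite semimat" where
  "mone = (\<lambda>\<alpha> \<beta>. if \<alpha> = \<beta> then 1 else 0)"

definition mtranspose :: "'d::finite semimat \<Rightarrow> 'd semimat" where
  "mtranspose A = (\<lambda>\<alpha> \<beta>. A \<beta> \<alpha>)"

fun mpow :: "'d::finite semimat \<Rightarrow> nat \<Rightarrow> 'd semimat" where
  "mpow A 0 = mone"
| "mpow A (Suc n) = A \<odot> mpow A n"

definition mexp :: "'d::finite semimat \<Rightarrow> 'd semimat" where
  "mexp A = (\<lambda>\<alpha> \<beta>. \<Sum>n. mpow A n \<alpha> \<beta> / fact n)"

text \<open>The product of a family of matrices over the coordinates, in increasing order.\<close>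

definition mprod :: "('d::{finite,linorder} \<Rightarrow> 'd semimat) \<Rightarrow> 'd semimat" where
  "mprod A = foldr (\<lambda>a B. A a \<odot> B) (sorted_list_of_set UNIV) mone"

definition block_lower :: "'d::finite semimat \<Rightarrow> bool" where
  "block_lower A \<longleftrightarrow> (\<forall>\<alpha> \<beta>. mdeg \<alpha> < mdeg \<beta> \<longrightarrow> A \<alpha> \<beta> = 0)"

definition block_unilower :: "'d::finite semimat \<Rightarrow> bool" where
  "block_unilower A \<longleftrightarrow>
     block_lower A \<and> (\<forall>\<alpha> \<beta>. mdeg \<alpha> = mdeg \<beta> \<longrightarrow> A \<alpha> \<beta> = mone \<alpha> \<beta>)"

definition block_diag :: "'d::finite semimat \<Rightarrow> bool" where
  "block_diag A \<longleftrightarrow> (\<forall>\<alpha> \<beta>. mdeg \<alpha> \<noteq> mdeg \<beta> \<longrightarrow> A \<alpha> \<beta> = 0)"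

text \<open>A block diagonal matrix all of whose diagonal blocks are invertible.\<close>

definition block_diag_invertible :: "'d::finite semimat \<Rightarrow> bool" where
  "block_diag_invertible A \<longleftrightarrow>
     block_diag A \<and> (\<exists>B. block_diag B \<and> A \<odot> B = mone \<and> B \<odot> A = mone)"

text \<open>
  Two-sided inverse within the block lower triangular matrices, where products are finite sums,
  so that multiplication is associative and the inverse is unique.  It is only applied to the
  unitriangular factor and to the invertible block diagonal factor below.
\<close>

definition minv :: "'d::finite semimat \<Rightarrow> 'd semimat" where
  "minv A = (THE B. block_lower B \<and> A \<odot> B = mone \<and> B \<odot> A = mone)"


subsection \<open>Shift matrices and flows\<close>

definition shift :: "'d::finite \<Rightarrow> 'd semimat" where
  "shift a = (\<lambda>\<alpha> \<beta>. if \<beta> = \<alpha> + axis a 1 then 1 else 0)"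

definition shift_power :: "nat ^ 'd::{finite,linorder} \<Rightarrow> 'd semimat" where
  "shift_power \<alpha> = mprod (\<lambda>a. mpow (shift a) (\<alpha> $ a))"

text \<open>
  For fixed \<open>\<beta>\<close>, \<open>\<gamma>\<close> at most one \<open>\<alpha>\<close> contributes to the entry \<open>(\<beta>, \<gamma>)\<close> of \<open>\<Sum>\<^sub>\<alpha> t\<^sub>\<alpha> \<Lambda>\<^sub>\<alpha>\<close>.
\<close>

definition times_matrix :: "'d::{finite,linorder} flow_times \<Rightarrow> 'd semimat" where
  "times_matrix t = (\<lambda>\<beta> \<gamma>. \<Sum>\<^sub>\<infinity>\<alpha>. t \<alpha> * shift_power \<alpha> \<beta> \<gamma>)"

definition shift_comb :: "real ^ 'd::finite \<Rightarrow> 'd semimat" where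
  "shift_comb n = (\<lambda>\<alpha> \<beta>. \<Sum>a\<in>UNIV. n $ a * shift a \<alpha> \<beta>)"

text \<open>
  Integer powers of \<open>n \<cdot> \<Lambda> - q\<close>; the negative ones are the powers of
  \<open>(n \<cdot> \<Lambda> - q)\<^sup>-\<^sup>1 = - \<Sum>\<^sub>j q\<^sup>-\<^sup>j\<^sup>-\<^sup>1 (n \<cdot> \<Lambda>)\<^sup>j\<close>, a series that is finite in each entry.
\<close>

definition linear_powi :: "real ^ 'd::finite \<Rightarrow> real \<Rightarrow> int \<Rightarrow> 'd semimat" where
  "linear_powi n q m =
     (if m \<ge> 0
      then mpow (\<lambda>\<alpha> \<beta>. shift_comb n \<alpha> \<beta> - q * mone \<alpha> \<beta>) (nat m)
      else mpow (\<lambda>\<alpha> \<beta>. - (\<Sum>j. mpow (shift_comb n) j \<alpha> \<beta> / q ^ (j + 1))) (nat (- m)))"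

definition W0 ::
  "'d::{finite,linorder} rmat \<Rightarrow> 'd rvec \<Rightarrow> 'd flow_times \<Rightarrow> 'd discrete_times \<Rightarrow> 'd semimat"
where
  "W0 N q t m = mexp (times_matrix t) \<odot> mprod (\<lambda>a. linear_powi (N $ a) (q $ a) (m $ a))"


subsection \<open>Moment matrix and Gauss--Borel factorization\<close>

definition msupport :: "(real ^ 'd::finite) measure \<Rightarrow> (real ^ 'd) set" where
  "msupport \<mu> = {x. \<forall>U. open U \<longrightarrow> x \<in> U \<longrightarrow> emeasure \<mu> U \<noteq> 0}"

definition moment_matrix :: "(real ^ 'd::finite) measure \<Rightarrow> 'd semimat" where
  "moment_matrix \<mu> = (\<lambda>\<alpha> \<beta>. \<integral>x. mpower x \<alpha> * mpower x \<beta> \<partial>\<mu>)"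

text \<open>
  The factorization \<open>G(t,m) = S\<^sup>-\<^sup>1 H (S\<^sup>-\<^sup>1)\<^sup>T\<close> of \<open>G(t,m) = W\<^sub>0(t,m) G\<close>.  It includes that the
  entries of \<open>W\<^sub>0(t,m) G\<close> are convergent series; for finitely many nonzero times this follows
  from the support condition on the measure, which makes the support compact.
\<close>

definition gauss_borel ::
  "'d::{finite,linorder} rmat \<Rightarrow> 'd rvec \<Rightarrow> 'd rvec measure \<Rightarrow>
   'd flow_times \<Rightarrow> 'd discrete_times \<Rightarrow> 'd semimat \<Rightarrow> 'd semimat \<Rightarrow> bool"
where
  "gauss_borel N q \<mu> t m S H \<longleftrightarrow>
     block_unilower S \<and> block_diag_invertible H \<and>
     has_mmul (W0 N q t m) (moment_matrix \<mu>) (minv S \<odot> H \<odot> mtranspose (minv S))"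


subsection \<open>Baker and adjoint Baker functions\<close>

definition chi :: "complex ^ 'd::finite \<Rightarrow> nat ^ 'd \<Rightarrow> complex" where
  "chi z = mpower z"

definition chi_star :: "complex ^ 'd::finite \<Rightarrow> nat ^ 'd \<Rightarrow> complex" where
  "chi_star z = (\<lambda>\<gamma>. (\<Prod>a\<in>UNIV. inverse (z $ a)) * chi (\<chi> a. inverse (z $ a)) \<gamma>)"

definition W1 ::
  "'d::{finite,linorder} rmat \<Rightarrow> 'd rvec \<Rightarrow> 'd flow_times \<Rightarrow> 'd discrete_times \<Rightarrow>
   'd semimat \<Rightarrow> 'd semimat"
where
  "W1 N q t m S = S \<odot> W0 N q t m"

definition W2 :: "'d::finite semimat \<Rightarrow> 'd semimat \<Rightarrow> 'd semimat" where
  "W2 S H = H \<odot> mtranspose (minv S)"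

definition Psi1 ::
  "'d::{finite,linorder} rmat \<Rightarrow> 'd rvec \<Rightarrow> 'd flow_times \<Rightarrow> 'd discrete_times \<Rightarrow>
   'd semimat \<Rightarrow> 'd cvec \<Rightarrow> 'd mindex \<Rightarrow> complex"
where
  "Psi1 N q t m S z = mvec (W1 N q t m S) (chi z)"

definition Psi2 :: "'d::finite semimat \<Rightarrow> 'd semimat \<Rightarrow> complex ^ 'd \<Rightarrow> nat ^ 'd \<Rightarrow> complex" where
  "Psi2 S H z = mvec (W2 S H) (chi_star z)"

text \<open>
  Since \<open>G = W\<^sub>1\<^sup>-\<^sup>1 W\<^sub>2\<close> with \<open>G\<close> and \<open>H\<close> symmetric, \<open>(W\<^sub>1\<^sup>-\<^sup>1)\<^sup>T = H\<^sup>-\<^sup>1 S G\<close>; here \<open>G\<close> is the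
  moment matrix of the initial measure.
\<close>

definition W1_inv_transpose ::
  "(real ^ 'd::finite) measure \<Rightarrow> 'd semimat \<Rightarrow> 'd semimat \<Rightarrow> 'd semimat"
where
  "W1_inv_transpose \<mu> S H = minv H \<odot> S \<odot> moment_matrix \<mu>"

definition Psi1_adj ::
  "(real ^ 'd::finite) measure \<Rightarrow> 'd semimat \<Rightarrow> 'd semimat \<Rightarrow> complex ^ 'd \<Rightarrow> nat ^ 'd \<Rightarrow> complex"
where
  "Psi1_adj \<mu> S H z = mvec (W1_inv_transpose \<mu> S H) (chi_star z)"

text \<open>\<open>\<Psi>\<^sub>2\<^sup>* = (W\<^sub>2\<^sup>-\<^sup>1)\<^sup>T \<chi> = H\<^sup>-\<^sup>1 P\<close> with \<open>P = S \<chi>\<close>.\<close>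

definition Psi2_adj :: "'d::finite semimat \<Rightarrow> 'd semimat \<Rightarrow> complex ^ 'd \<Rightarrow> nat ^ 'd \<Rightarrow> complex" where
  "Psi2_adj S H z = mvec (minv H) (mvec S (chi z))"


subsection \<open>Domains of convergence and integrals over tori\<close>

text \<open>
  Domain of convergence of the series in row \<open>\<alpha>\<close> of \<open>A \<chi>\<close> (a power series) and of \<open>A \<chi>\<^sup>*\<close> (a
  Laurent series): the interior of the set of points of absolute convergence.

  On its power domain \<open>\<Psi>\<^sub>1 = W\<^sub>1 \<chi>\<close> equals \<open>e\<^bsup>t(z)\<^esup> \<Prod>\<^sub>a (n\<^sub>a \<cdot> z - q\<^sub>a)\<^bsup>m\<^sub>a\<^esup> P(z)\<close>.  For finitely many
  nonzero times this domain is the whole space if all \<open>m\<^sub>a \<ge> 0\<close>, and in general it contains the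
  polydisks on which \<open>\<bar>n\<^sub>a \<cdot> z\<bar> < \<bar>q\<^sub>a\<bar>\<close> whenever \<open>m\<^sub>a < 0\<close>.  The torus carrying \<open>\<Psi>\<^sub>1\<close> has to lie
  in it: past the poles \<open>n\<^sub>a \<cdot> z = q\<^sub>a\<close> the value of the integral changes by residues, although
  \<open>\<Psi>\<^sub>1\<^sup>*\<close> still converges there.
\<close>

definition power_domain :: "'d::finite semimat \<Rightarrow> nat ^ 'd \<Rightarrow> (complex ^ 'd) set" where
  "power_domain A \<alpha> =
     interior {z. (\<lambda>\<gamma>. norm (of_real (A \<alpha> \<gamma>) * chi z \<gamma>)) summable_on UNIV}"

definition laurent_domain :: "'d::finite semimat \<Rightarrow> nat ^ 'd \<Rightarrow> (complex ^ 'd) set" where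
  "laurent_domain A \<alpha> =
     interior {z. (\<forall>a. z $ a \<noteq> 0) \<and>
                  (\<lambda>\<gamma>. norm (of_real (A \<alpha> \<gamma>) * chi_star z \<gamma>)) summable_on UNIV}"

definition complex_vec :: "real ^ 'd::finite \<Rightarrow> complex ^ 'd" where
  "complex_vec r = (\<chi> a. of_real (r $ a))"

text \<open>
  The integral of \<open>f dz\<^sub>1 \<dots> dz\<^sub>D\<close> over the torus of polyradius \<open>r\<close>, through the positively oriented
  parametrization \<open>z\<^sub>a = r\<^sub>a e\<^bsup>i\<theta>\<^sub>a\<^esup>\<close>, \<open>dz\<^sub>a = i z\<^sub>a d\<theta>\<^sub>a\<close>, \<open>0 \<le> \<theta>\<^sub>a \<le> 2\<pi>\<close>.
\<close>

definition torus_point :: "real ^ 'd::finite \<Rightarrow> real ^ 'd \<Rightarrow> complex ^ 'd" where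
  "torus_point r \<theta> = (\<chi> a. of_real (r $ a) * cis (\<theta> $ a))"

definition torus_integral :: "real ^ 'd::finite \<Rightarrow> (complex ^ 'd \<Rightarrow> complex) \<Rightarrow> complex" where
  "torus_integral r f =
     (LINT \<theta>:cbox 0 (\<chi> a. 2 * pi)|lborel.
        f (torus_point r \<theta>) * (\<Prod>a\<in>UNIV. \<i> * torus_point r \<theta> $ a))"

end

theory Submission
  imports Defs
begin

text \<open>
  On a torus the monomials \<open>z\<^sup>\<gamma>\<close> are dual to the entries \<open>z\<^sup>-\<^sup>\<delta>\<^sup>-\<^sup>1\<close> of \<open>\<chi>\<^sup>*\<close>, up to the factor
  \<open>(2 \<pi> \<i>)\<^sup>D\<close>, so both integrals reduce to matrix products: the left one to the entry
  \<open>(\<alpha>, \<beta>)\<close> of \<open>W\<^sub>1(t,m) W\<^sub>1(t',m')\<^sup>-\<^sup>1\<close> and the right one to that of \<open>W\<^sub>2(t,m) W\<^sub>2(t',m')\<^sup>-\<^sup>1\<close>.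
  These agree because both pairs factorize the same \<open>G\<close>.  Only the product \<open>W\<^sub>0 G\<close> involves
  infinite sums; the other factors are block lower triangular, so the products may be reassociated.
\<close>

section \<open>Sums over layers of multi-indices\<close>

lemma finite_mdeg_le: "finite {\<gamma> :: nat ^ 'd::finite. mdeg \<gamma> \<le> n}"
proof (rule finite_subset)
  show "{\<gamma> :: nat ^ 'd. mdeg \<gamma> \<le> n} \<subseteq> vec_lambda ` (UNIV \<rightarrow>\<^sub>E {..n})"
  proof
    fix \<gamma> :: "nat ^ 'd" assume "\<gamma> \<in> {\<gamma>. mdeg \<gamma> \<le> n}"
    then have "\<gamma> $ a \<le> n" for a
      using member_le_sum[of a UNIV "\<lambda>a. \<gamma> $ a"] by (auto simp: mdeg_def)
    then show "\<gamma> \<in> vec_lambda ` (UNIV \<rightarrow>\<^sub>E {..n})"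
      by (intro image_eqI[of _ _ "vec_nth \<gamma>"]) auto
  qed
  show "finite (vec_lambda ` (UNIV \<rightarrow>\<^sub>E {..n}) :: (nat ^ 'd) set)"
    by (intro finite_imageI finite_PiE) auto
qed

lemma finite_layer [simp]: "finite (layer k :: (nat ^ 'd::finite) set)"
  by (rule finite_subset[OF _ finite_mdeg_le[of k]]) (auto simp: layer_def)

lemma disjoint_layers: "j \<noteq> k \<Longrightarrow> layer j \<inter> layer k = {}"
  by (auto simp: layer_def)

lemma sum_layers_atMost:
  fixes f :: "nat ^ 'd::finite \<Rightarrow> 'a::comm_monoid_add"
  shows "(\<Sum>k\<le>n. \<Sum>\<gamma>\<in>layer k. f \<gamma>) = (\<Sum>\<gamma> | mdeg \<gamma> \<le> n. f \<gamma>)"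
proof -
  have "(\<Sum>k\<le>n. \<Sum>\<gamma>\<in>layer k. f \<gamma>) = sum f (\<Union>k\<in>{..n}. layer k)"
    using disjoint_layers by (intro sum.UNION_disjoint[symmetric]) auto
  also have "(\<Union>k\<in>{..n}. layer k) = {\<gamma> :: nat ^ 'd. mdeg \<gamma> \<le> n}"
    by (auto simp: layer_def)
  finally show ?thesis .
qed

lemma layers_sums_finite:
  fixes f :: "nat ^ 'd::finite \<Rightarrow> 'a::{comm_monoid_add,t2_space}"
  assumes "\<And>\<gamma>. n < mdeg \<gamma> \<Longrightarrow> f \<gamma> = 0"
  shows "(\<lambda>k. \<Sum>\<gamma>\<in>layer k. f \<gamma>) sums (\<Sum>\<gamma> | mdeg \<gamma> \<le> n. f \<gamma>)"
  unfolding sum_layers_atMost[symmetric]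
  by (rule sums_finite) (use assms in \<open>auto simp: layer_def intro!: sum.neutral\<close>)

section \<open>Products whose left factors are block lower triangular\<close>

lemma block_lower_mmul_eq:
  assumes "block_lower A"
  shows "(A \<odot> B) \<alpha> \<beta> = (\<Sum>\<gamma> | mdeg \<gamma> \<le> mdeg \<alpha>. A \<alpha> \<gamma> * B \<gamma> \<beta>)"
  unfolding mmul_def
  by (rule sums_unique[symmetric], rule layers_sums_finite)
    (use assms in \<open>auto simp: block_lower_def\<close>)

lemma block_lower_mvec_eq:
  assumes "block_lower A"
  shows "mvec A v \<alpha> = (\<Sum>\<gamma> | mdeg \<gamma> \<le> mdeg \<alpha>. of_real (A \<alpha> \<gamma>) * v \<gamma>)"
  unfolding mvec_def
  by (rule sums_unique[symmetric], rule layers_sums_finite)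
    (use assms in \<open>auto simp: block_lower_def\<close>)

text \<open>Rows of different degree come with sums of different length. Padding them with zeros to
  a common range makes double sums rectangular, so that they can be swapped.\<close>

lemma block_lower_sum_extend:
  fixes f :: "nat ^ 'd::finite \<Rightarrow> 'a::comm_monoid_add"
  assumes "\<And>\<gamma>. mdeg \<alpha> < mdeg \<gamma> \<Longrightarrow> f \<gamma> = 0" "mdeg \<alpha> \<le> n"
  shows "(\<Sum>\<gamma> | mdeg \<gamma> \<le> mdeg \<alpha>. f \<gamma>) = (\<Sum>\<gamma> | mdeg \<gamma> \<le> n. f \<gamma>)"
  using assms by (intro sum.mono_neutral_left finite_mdeg_le) (auto simp: not_le)

lemma block_lower_mmul:
  assumes "block_lower A" "block_lower B"
  shows "block_lower (A \<odot> B)"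
  unfolding block_lower_def block_lower_mmul_eq[OF assms(1)]
  using assms by (auto simp: block_lower_def intro!: sum.neutral)

text \<open>Starting from row \<open>\<alpha>\<close>, both inner indices stay in the finite set of
  degrees at most \<open>mdeg \<alpha>\<close>, so only finite sums are interchanged. As
  \<open>C\<close> is arbitrary, the lemma also covers block upper triangular last factors such as
  \<open>mtranspose (minv S)\<close>.\<close>

lemma block_lower_mmul_assoc:
  fixes A B C :: "'a::finite semimat"
  assumes A: "block_lower A" and B: "block_lower B"
  shows "(A \<odot> B) \<odot> C = A \<odot> (B \<odot> C)"
proof (intro ext)
  fix \<alpha> \<beta> :: "nat ^ 'a"
  let ?I = "{\<gamma> :: nat ^ 'a. mdeg \<gamma> \<le> mdeg \<alpha>}"
  have "((A \<odot> B) \<odot> C) \<alpha> \<beta> = (\<Sum>\<gamma>\<in>?I. \<Sum>\<delta>\<in>?I. A \<alpha> \<delta> * B \<delta> \<gamma> * C \<gamma> \<beta>)"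
    by (simp add: block_lower_mmul_eq block_lower_mmul A B sum_distrib_right)
  also have "\<dots> = (\<Sum>\<delta>\<in>?I. \<Sum>\<gamma>\<in>?I. A \<alpha> \<delta> * B \<delta> \<gamma> * C \<gamma> \<beta>)"
    by (rule sum.swap)
  also have "\<dots> = (\<Sum>\<delta>\<in>?I. A \<alpha> \<delta> * (\<Sum>\<gamma> | mdeg \<gamma> \<le> mdeg \<delta>. B \<delta> \<gamma> * C \<gamma> \<beta>))"
  proof (rule sum.cong[OF refl])
    fix \<delta> assume "\<delta> \<in> ?I"
    then have "(\<Sum>\<gamma> | mdeg \<gamma> \<le> mdeg \<delta>. B \<delta> \<gamma> * C \<gamma> \<beta>) = (\<Sum>\<gamma>\<in>?I. B \<delta> \<gamma> * C \<gamma> \<beta>)"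
      using B by (intro block_lower_sum_extend) (auto simp: block_lower_def)
    then show "(\<Sum>\<gamma>\<in>?I. A \<alpha> \<delta> * B \<delta> \<gamma> * C \<gamma> \<beta>) =
        A \<alpha> \<delta> * (\<Sum>\<gamma> | mdeg \<gamma> \<le> mdeg \<delta>. B \<delta> \<gamma> * C \<gamma> \<beta>)"
      by (simp add: sum_distrib_left mult.assoc)
  qed
  also have "\<dots> = (A \<odot> (B \<odot> C)) \<alpha> \<beta>"
    by (simp add: block_lower_mmul_eq A B)
  finally show "((A \<odot> B) \<odot> C) \<alpha> \<beta> = (A \<odot> (B \<odot> C)) \<alpha> \<beta>" .
qed

text \<open>This serves to write \<open>Psi2_adj\<close>, defined by two nested applications of
  \<open>mvec\<close>, as one polynomial in \<open>z\<close> with explicit coefficients.\<close>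

lemma block_lower_mvec_mvec:
  fixes A B :: "'a::finite semimat"
  assumes A: "block_lower A" and B: "block_lower B"
  shows "mvec A (mvec B v) = mvec (A \<odot> B) v"
proof (intro ext)
  fix \<alpha> :: "nat ^ 'a"
  let ?I = "{\<gamma> :: nat ^ 'a. mdeg \<gamma> \<le> mdeg \<alpha>}"
  have "mvec (A \<odot> B) v \<alpha> = (\<Sum>\<gamma>\<in>?I. \<Sum>\<delta>\<in>?I. of_real (A \<alpha> \<delta>) * of_real (B \<delta> \<gamma>) * v \<gamma>)"
    by (simp add: block_lower_mmul_eq block_lower_mvec_eq block_lower_mmul A B sum_distrib_right)
  also have "\<dots> = (\<Sum>\<delta>\<in>?I. \<Sum>\<gamma>\<in>?I. of_real (A \<alpha> \<delta>) * of_real (B \<delta> \<gamma>) * v \<gamma>)"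
    by (rule sum.swap)
  also have "\<dots> = (\<Sum>\<delta>\<in>?I. of_real (A \<alpha> \<delta>) * (\<Sum>\<gamma> | mdeg \<gamma> \<le> mdeg \<delta>. of_real (B \<delta> \<gamma>) * v \<gamma>))"
  proof (rule sum.cong[OF refl])
    fix \<delta> assume "\<delta> \<in> ?I"
    then have "(\<Sum>\<gamma> | mdeg \<gamma> \<le> mdeg \<delta>. complex_of_real (B \<delta> \<gamma>) * v \<gamma>)
        = (\<Sum>\<gamma>\<in>?I. of_real (B \<delta> \<gamma>) * v \<gamma>)"
      using B by (intro block_lower_sum_extend) (auto simp: block_lower_def)
    then show "(\<Sum>\<gamma>\<in>?I. of_real (A \<alpha> \<delta>) * of_real (B \<delta> \<gamma>) * v \<gamma>) =
        of_real (A \<alpha> \<delta>) * (\<Sum>\<gamma> | mdeg \<gamma> \<le> mdeg \<delta>. of_real (B \<delta> \<gamma>) * v \<gamma>)"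
      by (simp add: sum_distrib_left mult.assoc)
  qed
  also have "\<dots> = mvec A (mvec B v) \<alpha>"
    by (simp add: block_lower_mvec_eq A B)
  finally show "mvec A (mvec B v) \<alpha> = mvec (A \<odot> B) v \<alpha>" ..
qed

lemma block_lower_mone: "block_lower mone"
  by (auto simp: block_lower_def mone_def)

lemma mone_mmul [simp]: "mone \<odot> A = A"
  by (intro ext, subst block_lower_mmul_eq[OF block_lower_mone])
    (simp add: mone_def if_distrib[of "\<lambda>x. x * _"] finite_mdeg_le cong: if_cong)

lemma block_lower_mmul_mone [simp]:
  assumes A: "block_lower A"
  shows "A \<odot> mone = A"
  by (intro ext, subst block_lower_mmul_eq[OF A])
    (use A in \<open>auto simp: mone_def block_lower_def not_le
      if_distrib[of "\<lambda>x. _ * x"] finite_mdeg_le cong: if_cong\<close>)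

section \<open>Inverses of unitriangular and of block diagonal matrices\<close>

lemma minv_eqI:
  assumes "block_lower A" "block_lower B" "A \<odot> B = mone" "B \<odot> A = mone"
  shows "minv A = B"
  unfolding minv_def
proof (rule the_equality)
  fix C assume C: "block_lower C \<and> A \<odot> C = mone \<and> C \<odot> A = mone"
  have "C = C \<odot> (A \<odot> B)"
    using assms C by simp
  also have "\<dots> = B"
    using assms C block_lower_mmul_assoc[of C A B] by simp
  finally show "C = B" .
qed (use assms in blast)

text \<open>Forward substitution: for unitriangular \<open>A\<close> the equation
  \<open>A \<odot> X = mone\<close> determines each row of \<open>X\<close> from the rows of smaller
  degree.\<close>

function unilower_right_inverse :: "'d::finite semimat \<Rightarrow> 'd semimat" where
  "unilower_right_inverse A \<alpha> \<beta> =
     mone \<alpha> \<beta> - (\<Sum>\<gamma> | mdeg \<gamma> < mdeg \<alpha>. A \<alpha> \<gamma> * unilower_right_inverse A \<gamma> \<beta>)"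
  by pat_completeness auto
termination
  by (relation "Wellfounded.measure (\<lambda>(A, \<alpha>, \<beta>). mdeg \<alpha>)") auto

declare unilower_right_inverse.simps [simp del]

lemma block_unilower_mmul_split:
  assumes "block_unilower A"
  shows "(A \<odot> B) \<alpha> \<beta> = B \<alpha> \<beta> + (\<Sum>\<gamma> | mdeg \<gamma> < mdeg \<alpha>. A \<alpha> \<gamma> * B \<gamma> \<beta>)"
proof -
  have self: "\<alpha> \<in> layer (mdeg \<alpha>)"
    by (simp add: layer_def)
  have "(A \<odot> B) \<alpha> \<beta> = (\<Sum>\<gamma> | mdeg \<gamma> \<le> mdeg \<alpha>. A \<alpha> \<gamma> * B \<gamma> \<beta>)"
    using assms by (simp add: block_lower_mmul_eq block_unilower_def)
  also have "{\<gamma>. mdeg \<gamma> \<le> mdeg \<alpha>} = layer (mdeg \<alpha>) \<union> {\<gamma>. mdeg \<gamma> < mdeg \<alpha>}"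
    by (auto simp: layer_def)
  also have "(\<Sum>\<gamma>\<in>\<dots>. A \<alpha> \<gamma> * B \<gamma> \<beta>) =
      (\<Sum>\<gamma>\<in>layer (mdeg \<alpha>). A \<alpha> \<gamma> * B \<gamma> \<beta>) + (\<Sum>\<gamma> | mdeg \<gamma> < mdeg \<alpha>. A \<alpha> \<gamma> * B \<gamma> \<beta>)"
    by (rule sum.union_disjoint)
      (auto simp: layer_def intro: finite_subset[OF _ finite_mdeg_le[of "mdeg \<alpha>"]])
  also have "(\<Sum>\<gamma>\<in>layer (mdeg \<alpha>). A \<alpha> \<gamma> * B \<gamma> \<beta>) = (\<Sum>\<gamma>\<in>layer (mdeg \<alpha>). if \<gamma> = \<alpha> then B \<gamma> \<beta> else 0)"
    using assms by (intro sum.cong) (auto simp: block_unilower_def layer_def mone_def)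
  also have "\<dots> = B \<alpha> \<beta>"
    using self by simp
  finally show ?thesis .
qed

lemma unilower_right_inverse_right:
  assumes "block_unilower A"
  shows "A \<odot> unilower_right_inverse A = mone"
proof (intro ext)
  fix \<alpha> \<beta>
  show "(A \<odot> unilower_right_inverse A) \<alpha> \<beta> = mone \<alpha> \<beta>"
    unfolding block_unilower_mmul_split[OF assms]
    by (subst unilower_right_inverse.simps) simp
qed

lemma block_unilower_unilower_right_inverse:
  fixes A :: "'a::finite semimat"
  shows "block_unilower (unilower_right_inverse A)"
proof -
  \<comment> \<open>Every row \<open>\<gamma>\<close> in the recursion has degree below
    \<open>mdeg \<beta>\<close>, so by induction its entry is that of \<open>mone\<close> and
    vanishes. Hence the whole correction sum is zero.\<close>
  have *: "unilower_right_inverse A \<alpha> \<beta> = mone \<alpha> \<beta>" if "mdeg \<alpha> \<le> mdeg \<beta>" for \<alpha> \<beta>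
    using that
  proof (induction "mdeg \<alpha>" arbitrary: \<alpha> rule: less_induct)
    case less
    have "unilower_right_inverse A \<gamma> \<beta> = 0" if "mdeg \<gamma> < mdeg \<alpha>" for \<gamma>
    proof -
      have "unilower_right_inverse A \<gamma> \<beta> = mone \<gamma> \<beta>"
        using less.hyps[of \<gamma>] less.prems that by simp
      also have "\<dots> = 0"
        using less.prems that by (auto simp: mone_def)
      finally show ?thesis .
    qed
    then show ?case
      by (subst unilower_right_inverse.simps) simp
  qed
  show ?thesis
    unfolding block_unilower_def block_lower_def
  proof (intro conjI allI impI)
    fix \<alpha> \<beta> :: "nat ^ 'a"
    show "unilower_right_inverse A \<alpha> \<beta> = mone \<alpha> \<beta>" if "mdeg \<alpha> = mdeg \<beta>"
      using that by (intro *) simp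
    assume less: "mdeg \<alpha> < mdeg \<beta>"
    then have "unilower_right_inverse A \<alpha> \<beta> = mone \<alpha> \<beta>"
      by (intro *) simp
    also have "\<dots> = 0"
      using less by (auto simp: mone_def)
    finally show "unilower_right_inverse A \<alpha> \<beta> = 0" .
  qed
qed

text \<open>The right inverse of a unitriangular matrix has a right inverse itself, so it is two-sided.\<close>

lemma block_unilower_minv:
  assumes "block_unilower A"
  shows "block_lower (minv A)" "A \<odot> minv A = mone" "minv A \<odot> A = mone"
proof -
  define B where "B = unilower_right_inverse A"
  define C where "C = unilower_right_inverse B"
  have lower: "block_lower A" "block_lower B" "block_lower C"
    using assms block_unilower_unilower_right_inverse
    by (auto simp: B_def C_def block_unilower_def)
  have AB: "A \<odot> B = mone" and BC: "B \<odot> C = mone"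
    unfolding C_def
    by (simp_all add: B_def unilower_right_inverse_right assms block_unilower_unilower_right_inverse)
  have "A = A \<odot> (B \<odot> C)"
    by (simp add: BC lower)
  also have "\<dots> = C"
    using block_lower_mmul_assoc[of A B C] by (simp add: AB lower)
  finally have BA: "B \<odot> A = mone"
    using BC by simp
  have "minv A = B"
    by (rule minv_eqI) (use lower AB BA in auto)
  then show "block_lower (minv A)" "A \<odot> minv A = mone" "minv A \<odot> A = mone"
    using lower AB BA by simp_all
qed

lemma block_diag_lower: "block_diag A \<Longrightarrow> block_lower A"
  by (auto simp: block_diag_def block_lower_def)

text \<open>The block diagonal inverse is in particular block lower triangular, so uniqueness
  identifies it with \<open>minv A\<close>.\<close>

lemma block_diag_invertible_minv_lower:
  assumes "block_diag_invertible A"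
  shows "block_lower (minv A)"
proof -
  obtain B where B: "block_lower A" "block_lower B" "A \<odot> B = mone" "B \<odot> A = mone"
    using assms by (auto simp: block_diag_invertible_def dest: block_diag_lower)
  then show ?thesis
    using minv_eqI[OF B] by simp
qed

section \<open>Orthogonality of monomials on the torus\<close>

lemma lborel_integral_prod_vec:
  fixes f :: "'d::finite \<Rightarrow> real \<Rightarrow> complex"
  assumes "\<And>a. integrable lborel (f a)"
  shows "(\<integral>\<theta>. (\<Prod>a\<in>UNIV. f a (\<theta> $ a)) \<partial>(lborel :: (real ^ 'd) measure)) =
         (\<Prod>a\<in>UNIV. integral\<^sup>L lborel (f a))"
proof -
  interpret product_sigma_finite "\<lambda>b :: real ^ 'd. lborel :: real measure" ..
  have f [measurable]: "f a \<in> borel_measurable borel" for a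
    using borel_measurable_integrable[OF assms] by simp
  have inj: "inj (\<lambda>a :: 'd. axis a (1::real))"
    by (simp add: inj_on_def axis_eq_axis)
  have basis: "(Basis :: (real ^ 'd) set) = range (\<lambda>a. axis a 1)"
    by (auto simp: Basis_vec_def)
  \<comment> \<open>The product measure behind \<open>lborel\<close> is indexed by basis vectors
    instead of coordinates; \<open>g\<close> carries the family \<open>f\<close> along the bijection
    from \<open>a\<close> to \<open>axis a 1\<close>.\<close>
  define g where "g b = f (THE a. b = axis a 1)" for b :: "real ^ 'd"
  have g: "g (axis a 1) = f a" for a
    by (simp add: g_def axis_eq_axis)
  have "(\<integral>\<theta>. (\<Prod>a\<in>UNIV. f a (\<theta> $ a)) \<partial>(lborel :: (real ^ 'd) measure)) =
      (\<integral>x. (\<Prod>a\<in>UNIV. f a ((\<Sum>b\<in>Basis. x b *\<^sub>R b) $ a)) \<partial>(\<Pi>\<^sub>M b\<in>(Basis :: (real ^ 'd) set). lborel))"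
    unfolding lborel_eq[where 'a = "real ^ 'd"] by (rule integral_distr) measurable
  also have "\<dots> = (\<integral>x. (\<Prod>b\<in>Basis. g b (x b)) \<partial>(\<Pi>\<^sub>M b\<in>(Basis :: (real ^ 'd) set). lborel))"
  proof (rule Bochner_Integration.integral_cong[OF refl])
    fix x :: "real ^ 'd \<Rightarrow> real"
    have "(\<Sum>b\<in>Basis. x b *\<^sub>R b) $ a = x (axis a 1)" for a :: 'd
      using inner_sum_left_Basis[of "axis a 1" x] unfolding inner_axis by (simp add: basis)
    then show "(\<Prod>a\<in>UNIV. f a ((\<Sum>b\<in>Basis. x b *\<^sub>R b) $ a)) = (\<Prod>b\<in>Basis. g b (x b))"
      by (simp add: basis prod.reindex[OF inj] g)
  qed
  also have "\<dots> = (\<Prod>b\<in>Basis. integral\<^sup>L lborel (g b))"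
    by (rule product_integral_prod) (auto simp: basis g assms)
  also have "\<dots> = (\<Prod>a\<in>UNIV. integral\<^sup>L lborel (f a))"
    by (simp add: basis prod.reindex[OF inj] g)
  finally show ?thesis .
qed

text \<open>This is the contour integral of \<open>z ^ n * inverse z ^ (m + 1)\<close>: of
  \<open>dz = \<i> z d\<theta>\<close> only the factor \<open>\<i>\<close> is left, since
  \<open>z\<close> cancels the prefactor of \<open>chi_star\<close>. So the residue is nonzero
  exactly for \<open>n = m\<close>.\<close>

lemma circle_integral_power_inverse:
  fixes r :: real
  assumes "r > 0"
  defines "f \<equiv> \<lambda>n m \<theta>. indicator {0..2 * pi} \<theta> *\<^sub>R
      (\<i> * ((of_real r * cis \<theta>) ^ n * inverse (of_real r * cis \<theta>) ^ m))"
  shows "integrable lborel (f n m)"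
    and "integral\<^sup>L lborel (f n m) = (if n = m then 2 * pi * \<i> else 0)"
proof -
  have eq: "(of_real r * cis \<theta>) ^ n * inverse (of_real r * cis \<theta>) ^ m =
      of_real (r ^ n * inverse r ^ m) * cis ((real n - real m) * \<theta>)" for \<theta>
  proof -
    have "cis \<theta> ^ n * cis (- \<theta>) ^ m = cis ((real n - real m) * \<theta>)"
      unfolding Complex.DeMoivre cis_mult by (rule arg_cong[where f = cis]) (simp add: algebra_simps)
    then show ?thesis
      by (simp add: power_mult_distrib)
  qed
  have cont: "continuous_on {0..2 * pi}
      (\<lambda>\<theta>. \<i> * ((of_real r * cis \<theta>) ^ n * inverse (of_real r * cis \<theta>) ^ m))"
    unfolding eq by (intro continuous_intros)
  then show "integrable lborel (f n m)"
    unfolding f_def using borel_integrable_atLeastAtMost'[of 0 "2 * pi"]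
    by (simp add: set_integrable_def)
  show "integral\<^sup>L lborel (f n m) = (if n = m then 2 * pi * \<i> else 0)"
  proof (cases "n = m")
    case True
    then have "f n m \<theta> = indicator {0..2 * pi} \<theta> *\<^sub>R \<i>" for \<theta>
      using assms(1) unfolding f_def eq by (simp add: power_inverse)
    then have "integral\<^sup>L lborel (f n m) = (\<integral>\<theta>. indicator {0..2 * pi} \<theta> *\<^sub>R \<i> \<partial>lborel)"
      by presburger
    also have "\<dots> = 2 * pi * \<i>"
      by (subst integral_scaleR_left) (auto simp: scaleR_conv_of_real)
    finally show ?thesis using True by simp
  next
    case False
    define d where "d = real n - real m"
    have d: "d \<noteq> 0" using False by (simp add: d_def)
    \<comment> \<open>An antiderivative: dividing by \<open>d\<close> offsets the factor from the
      chain rule.\<close>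
    define F where "F \<theta> = of_real (r ^ n * inverse r ^ m / d) * cis (d * \<theta>)" for \<theta>
    have "(F has_vector_derivative \<i> * ((of_real r * cis \<theta>) ^ n * inverse (of_real r * cis \<theta>) ^ m))
        (at \<theta> within {0..2 * pi})" for \<theta>
    proof -
      let ?c = "complex_of_real (r ^ n * inverse r ^ m)"
      have "((\<lambda>z. ?c / of_real d * exp (\<i> * of_real d * z)) has_field_derivative
          \<i> * (?c * exp (\<i> * of_real d * of_real \<theta>))) (at (of_real \<theta>))"
        using d by (auto intro!: derivative_eq_intros)
      from has_vector_derivative_real_field[OF this, of "{0..2 * pi}"] show ?thesis
        unfolding F_def eq d_def[symmetric] unfolding cis_conv_exp
        by (simp add: mult.assoc)
    qed
    then have "integral\<^sup>L lborel (f n m) = F (2 * pi) - F 0"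
      unfolding f_def by (intro integral_FTC_atLeastAtMost cont) auto
    \<comment> \<open>As a difference of two naturals, \<open>d\<close> is an integer, so
      \<open>F\<close> takes the same value at both ends of the interval.\<close>
    moreover have "cis (d * (2 * pi)) = 1"
      using cis_multiple_2pi[of d] by (simp add: d_def mult.commute)
    then have "F (2 * pi) - F 0 = 0"
      by (simp add: F_def)
    ultimately show ?thesis using False by simp
  qed
qed

lemma chi_torus_point: "chi (torus_point r \<theta>) \<gamma> = (\<Prod>a\<in>UNIV. (of_real (r $ a) * cis (\<theta> $ a)) ^ (\<gamma> $ a))"
  by (simp add: chi_def mpower_def torus_point_def)

text \<open>Moduli of monomials depend on the radii only, so absolute convergence at the single
  point \<open>complex_vec r\<close> yields bounds that are uniform on the torus.\<close>

lemma norm_chi_torus_point: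
  "norm (chi (torus_point r \<theta>) \<gamma>) = norm (chi (complex_vec r) \<gamma>)"
  by (simp add: chi_def mpower_def complex_vec_def torus_point_def norm_mult norm_power prod_norm[symmetric])

text \<open>The Jacobian factors \<open>\<i> z\<^sub>a\<close> cancel the prefactor of \<open>\<chi>\<^sup>*\<close>.\<close>

lemma chi_star_torus_point:
  assumes "\<And>a. r $ a > 0"
  shows "chi_star (torus_point r \<theta>) \<delta> * (\<Prod>a\<in>UNIV. \<i> * torus_point r \<theta> $ a) =
    (\<Prod>a\<in>UNIV. \<i> * inverse (of_real (r $ a) * cis (\<theta> $ a)) ^ (\<delta> $ a))"
proof -
  have nz: "torus_point r \<theta> $ a \<noteq> 0" for a
    using assms[of a] by (simp add: torus_point_def)
  have "of_real (r $ a) * cis (\<theta> $ a) = torus_point r \<theta> $ a" for a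
    by (simp add: torus_point_def)
  then show ?thesis
    unfolding chi_star_def chi_def mpower_def prod.distrib[symmetric]
    using nz by (intro prod.cong) (simp_all add: field_simps)
qed

lemma norm_chi_star_torus_point:
  "norm (chi_star (torus_point r \<theta>) \<delta>) = norm (chi_star (complex_vec r) \<delta>)"
  by (simp add: chi_star_def chi_def mpower_def torus_point_def complex_vec_def norm_mult norm_power
      norm_inverse prod_norm[symmetric])

text \<open>The indicator of the cube and the integrand both factor over the coordinates. The
  resulting product of circle integrals vanishes as soon as \<open>\<gamma>\<close> and
  \<open>\<delta>\<close> differ in one coordinate.\<close>

lemma torus_integral_chi_chi_star:
  fixes r :: "real ^ 'd::finite"
  assumes "\<And>a. r $ a > 0"
  shows "torus_integral r (\<lambda>z. chi z \<gamma> * chi_star z \<delta>) = (if \<gamma> = \<delta> then (2 * pi * \<i>) ^ CARD('d) else 0)"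
proof -
  let ?f = "\<lambda>a x. indicator {0..2 * pi} x *\<^sub>R
    (\<i> * ((of_real (r $ a) * cis x) ^ (\<gamma> $ a) * inverse (of_real (r $ a) * cis x) ^ (\<delta> $ a)))"
  have ind: "indicator (cbox 0 (\<chi> a. 2 * pi)) \<theta> = (\<Prod>a\<in>UNIV. indicator {0..2 * pi} (\<theta> $ a) :: real)"
    for \<theta> :: "real ^ 'd"
    by (auto simp: indicator_def mem_box_cart intro: ccontr)
  have "torus_integral r (\<lambda>z. chi z \<gamma> * chi_star z \<delta>) =
      (\<integral>\<theta>. (\<Prod>a\<in>UNIV. ?f a (\<theta> $ a)) \<partial>(lborel :: (real ^ 'd) measure))"
    unfolding torus_integral_def set_lebesgue_integral_def mult.assoc chi_star_torus_point[OF assms]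
    unfolding chi_torus_point ind
    by (simp add: scaleR_conv_of_real prod.distrib mult_ac)
  also have "\<dots> = (\<Prod>a\<in>UNIV. if \<gamma> $ a = \<delta> $ a then 2 * pi * \<i> else 0)"
    by (subst lborel_integral_prod_vec) (use circle_integral_power_inverse[OF assms] in auto)
  also have "\<dots> = (if \<gamma> = \<delta> then (2 * pi * \<i>) ^ CARD('d) else 0)"
    by (auto simp: vec_eq_iff)
  finally show ?thesis .
qed

text \<open>Termwise integration is done twice, first over \<open>k\<close> with the whole second
  series as a bounded factor, then over \<open>l\<close>. On a finite measure space the uniform
  bounds give integrability of each term and summability of the integrals of norms.\<close>

lemma (in finite_measure) integral_mult_series:
  fixes u v :: "nat \<Rightarrow> 'a \<Rightarrow> complex"
  assumes [measurable]: "\<And>k. u k \<in> borel_measurable M" "\<And>l. v l \<in> borel_measurable M"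
    and u: "\<And>k x. norm (u k x) \<le> U k" "summable U"
    and v: "\<And>l x. norm (v l x) \<le> V l" "summable V"
  shows "(\<integral>x. (\<Sum>k. u k x) * (\<Sum>l. v l x) \<partial>M) = (\<Sum>k. \<Sum>l. \<integral>x. u k x * v l x \<partial>M)"
proof -
  have [simp]: "summable (\<lambda>k. norm (u k x))" "summable (\<lambda>l. norm (v l x))" for x
    using u v by (auto intro: summable_comparison_test')
  have v_le: "norm (\<Sum>l. v l x) \<le> suminf V" for x
    using suminf_le[OF v(1)] by (intro order_trans[OF summable_norm]) (auto simp: v(2))
  have bounded: "integrable M f" "(\<integral>x. norm (f x) \<partial>M) \<le> B * measure M (space M)"
    if [measurable]: "f \<in> borel_measurable M" and "\<And>x. norm (f x) \<le> B" for f :: "'a \<Rightarrow> complex" and B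
  proof -
    show int: "integrable M f"
      by (rule integrable_const_bound[where B = B]) (use that in auto)
    have "(\<integral>x. norm (f x) \<partial>M) \<le> (\<integral>x. B \<partial>M)"
      by (rule integral_mono) (use int that in auto)
    then show "(\<integral>x. norm (f x) \<partial>M) \<le> B * measure M (space M)"
      by (simp add: mult.commute)
  qed
  have U0: "0 \<le> U k" and V0: "0 \<le> V k" for k
    using u(1) v(1) norm_ge_zero order_trans by blast+
  have "(\<integral>x. (\<Sum>k. u k x) * (\<Sum>l. v l x) \<partial>M) = (\<integral>x. (\<Sum>k. u k x * (\<Sum>l. v l x)) \<partial>M)"
    by (simp add: suminf_mult2 summable_norm_cancel)
  also have "\<dots> = (\<Sum>k. \<integral>x. u k x * (\<Sum>l. v l x) \<partial>M)"
  proof (rule integral_suminf)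
    have le: "norm (u k x * (\<Sum>l. v l x)) \<le> U k * suminf V" for k x
      unfolding norm_mult by (intro mult_mono u v_le U0) auto
    show "integrable M (\<lambda>x. u k x * (\<Sum>l. v l x))" for k
      by (rule bounded(1)[OF _ le]) measurable
    show "AE x in M. summable (\<lambda>k. norm (u k x * (\<Sum>l. v l x)))"
      by (simp add: norm_mult summable_mult2)
    show "summable (\<lambda>k. \<integral>x. norm (u k x * (\<Sum>l. v l x)) \<partial>M)"
    proof (rule summable_comparison_test'[where N = 0])
      show "summable (\<lambda>k. U k * suminf V * measure M (space M))"
        by (intro summable_mult2 u(2))
      show "norm (\<integral>x. norm (u k x * (\<Sum>l. v l x)) \<partial>M) \<le> U k * suminf V * measure M (space M)" for k
        using bounded(2)[OF _ le[where k = k]] by simp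
    qed
  qed
  also have "\<dots> = (\<Sum>k. \<Sum>l. \<integral>x. u k x * v l x \<partial>M)"
  proof (rule suminf_cong)
    fix k
    have le: "norm (u k x * v l x) \<le> U k * V l" for l x
      unfolding norm_mult by (intro mult_mono u v U0) auto
    have "(\<integral>x. u k x * (\<Sum>l. v l x) \<partial>M) = (\<integral>x. (\<Sum>l. u k x * v l x) \<partial>M)"
      by (simp add: suminf_mult summable_norm_cancel)
    also have "\<dots> = (\<Sum>l. \<integral>x. u k x * v l x \<partial>M)"
    proof (rule integral_suminf)
      show "integrable M (\<lambda>x. u k x * v l x)" for l
        by (rule bounded(1)[OF _ le]) measurable
      show "AE x in M. summable (\<lambda>l. norm (u k x * v l x))"
        by (simp add: norm_mult summable_mult)
      show "summable (\<lambda>l. \<integral>x. norm (u k x * v l x) \<partial>M)"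
      proof (rule summable_comparison_test'[where N = 0])
        show "summable (\<lambda>l. U k * V l * measure M (space M))"
          by (intro summable_mult2 summable_mult v(2))
        show "norm (\<integral>x. norm (u k x * v l x) \<partial>M) \<le> U k * V l * measure M (space M)" for l
          using bounded(2)[OF _ le[where l = l]] by simp
      qed
    qed
    finally show "(\<integral>x. u k x * (\<Sum>l. v l x) \<partial>M) = (\<Sum>l. \<integral>x. u k x * v l x \<partial>M)" .
  qed
  finally show ?thesis .
qed

text \<open>Premises \<open>a\<close> and \<open>b\<close> dominate both series uniformly on the
  torus, which permits termwise integration. Orthogonality then leaves the diagonal pairs, whose
  layerwise sum is named by \<open>ab\<close>.\<close>

lemma torus_integral_power_laurent:
  fixes r :: "real ^ 'd::finite" and a b :: "nat ^ 'd \<Rightarrow> complex"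
  assumes r: "\<And>a. r $ a > 0"
    and a: "summable (\<lambda>k. \<Sum>\<gamma>\<in>layer k. norm (a \<gamma> * chi (complex_vec r) \<gamma>))"
    and b: "summable (\<lambda>k. \<Sum>\<gamma>\<in>layer k. norm (b \<gamma> * chi_star (complex_vec r) \<gamma>))"
    and ab: "(\<lambda>k. \<Sum>\<gamma>\<in>layer k. a \<gamma> * b \<gamma>) sums s"
  shows "torus_integral r (\<lambda>z. (\<Sum>k. \<Sum>\<gamma>\<in>layer k. a \<gamma> * chi z \<gamma>) *
                               (\<Sum>l. \<Sum>\<delta>\<in>layer l. b \<delta> * chi_star z \<delta>)) =
         (2 * pi * \<i>) ^ CARD('d) * s"
proof -
  let ?z = "torus_point r"
  define Q :: "(real ^ 'd) measure" where "Q = restrict_space lborel (cbox 0 (\<chi> a. 2 * pi))"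
  define J where "J \<theta> = (\<Prod>a\<in>UNIV. \<i> * ?z \<theta> $ a)" for \<theta>
  define u where "u k \<theta> = (\<Sum>\<gamma>\<in>layer k. a \<gamma> * chi (?z \<theta>) \<gamma>)" for k \<theta>
  \<comment> \<open>The Jacobian is put into the second series, next to the prefactor of
    \<open>chi_star\<close> that it cancels.\<close>
  define v where "v l \<theta> = (\<Sum>\<delta>\<in>layer l. b \<delta> * chi_star (?z \<theta>) \<delta>) * J \<theta>" for l \<theta>
  have integral_Q: "torus_integral r f = (\<integral>\<theta>. f (?z \<theta>) * J \<theta> \<partial>Q)" for f
    by (simp add: torus_integral_def set_lebesgue_integral_def Q_def integral_restrict_space J_def)
  interpret finite_measure Q
    by (rule finite_measureI) (simp add: Q_def emeasure_restrict_space space_restrict_space emeasure_lborel_cbox_eq)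
  have meas: "f \<in> borel_measurable Q" if "continuous_on UNIV f" for f :: "real ^ 'd \<Rightarrow> complex"
    unfolding Q_def using borel_measurable_continuous_onI[OF that] by (auto intro: measurable_restrict_space1)
  have r0: "r $ a \<noteq> 0" for a using r[of a] by simp
  have cont_chi: "continuous_on UNIV (\<lambda>\<theta>. chi (?z \<theta>) \<gamma>)" for \<gamma>
    unfolding chi_torus_point by (intro continuous_intros)
  have cont_z: "continuous_on UNIV (\<lambda>\<theta>. ?z \<theta> $ a)" for a
    unfolding torus_point_def by (auto intro!: continuous_intros)
  have cont_star: "continuous_on UNIV (\<lambda>\<theta>. chi_star (?z \<theta>) \<delta> * J \<theta>)" for \<delta>
    unfolding J_def chi_star_torus_point[OF r] by (auto intro!: continuous_intros simp: r0)
  have norm_J: "norm (J \<theta>) = (\<Prod>a\<in>UNIV. r $ a)" for \<theta>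
    using r by (simp add: J_def torus_point_def norm_mult prod_norm[symmetric] less_imp_le)
  have norm_u: "norm (u k \<theta>) \<le> (\<Sum>\<gamma>\<in>layer k. norm (a \<gamma> * chi (complex_vec r) \<gamma>))" for k \<theta>
    unfolding u_def by (rule order_trans[OF norm_sum]) (simp add: norm_mult norm_chi_torus_point)
  have norm_v: "norm (v l \<theta>) \<le>
      (\<Sum>\<delta>\<in>layer l. norm (b \<delta> * chi_star (complex_vec r) \<delta>)) * (\<Prod>a\<in>UNIV. r $ a)" for l \<theta>
    unfolding v_def norm_mult[of _ "J \<theta>"] norm_J
    by (intro mult_right_mono order_trans[OF norm_sum] prod_nonneg)
      (auto simp: norm_mult norm_chi_star_torus_point r less_imp_le)
  have sum_v: "(\<Sum>l. \<Sum>\<delta>\<in>layer l. b \<delta> * chi_star (?z \<theta>) \<delta>) * J \<theta> = (\<Sum>l. v l \<theta>)" for \<theta>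
    unfolding v_def
  proof (rule suminf_mult2)
    show "summable (\<lambda>l. \<Sum>\<delta>\<in>layer l. b \<delta> * chi_star (?z \<theta>) \<delta>)"
      by (rule summable_comparison_test'[OF b, where N = 0], rule order_trans[OF norm_sum])
        (simp add: norm_mult norm_chi_star_torus_point)
  qed
  \<comment> \<open>Distinct layers share no multi-index, so orthogonality makes these integrals
    diagonal in \<open>k\<close> and \<open>l\<close>.\<close>
  have uv: "(\<integral>\<theta>. u k \<theta> * v l \<theta> \<partial>Q) =
      (if k = l then (2 * pi * \<i>) ^ CARD('d) * (\<Sum>\<gamma>\<in>layer k. a \<gamma> * b \<gamma>) else 0)" for k l
  proof -
    have int: "integrable Q (\<lambda>\<theta>. chi (?z \<theta>) \<gamma> * (chi_star (?z \<theta>) \<delta> * J \<theta>))" for \<gamma> \<delta>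
    proof (rule integrable_const_bound)
      show "(\<lambda>\<theta>. chi (?z \<theta>) \<gamma> * (chi_star (?z \<theta>) \<delta> * J \<theta>)) \<in> borel_measurable Q"
        by (intro meas continuous_intros cont_chi cont_star)
      show "AE \<theta> in Q. norm (chi (?z \<theta>) \<gamma> * (chi_star (?z \<theta>) \<delta> * J \<theta>)) \<le>
          norm (chi (complex_vec r) \<gamma>) * (norm (chi_star (complex_vec r) \<delta>) * (\<Prod>a\<in>UNIV. r $ a))"
        by (simp add: norm_mult norm_J norm_chi_star_torus_point norm_chi_torus_point)
    qed
    have "(\<integral>\<theta>. u k \<theta> * v l \<theta> \<partial>Q) = (\<integral>\<theta>. (\<Sum>\<gamma>\<in>layer k. \<Sum>\<delta>\<in>layer l.
        (a \<gamma> * b \<delta>) * (chi (?z \<theta>) \<gamma> * (chi_star (?z \<theta>) \<delta> * J \<theta>))) \<partial>Q)"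
      unfolding u_def v_def sum_distrib_right[of _ _ "J _"] sum_product by (simp add: mult_ac)
    also have "\<dots> = (\<Sum>\<gamma>\<in>layer k. \<Sum>\<delta>\<in>layer l.
        (a \<gamma> * b \<delta>) * (\<integral>\<theta>. chi (?z \<theta>) \<gamma> * (chi_star (?z \<theta>) \<delta> * J \<theta>) \<partial>Q))"
      by (simp add: int)
    also have "\<dots> = (\<Sum>\<gamma>\<in>layer k. \<Sum>\<delta>\<in>layer l.
        (if \<gamma> = \<delta> then (2 * pi * \<i>) ^ CARD('d) * (a \<gamma> * b \<gamma>) else 0))"
      using torus_integral_chi_chi_star[OF r, unfolded integral_Q]
      by (intro sum.cong refl) (simp add: mult.assoc[symmetric])
    also have "\<dots> = (\<Sum>\<gamma>\<in>layer k. if \<gamma> \<in> layer l then (2 * pi * \<i>) ^ CARD('d) * (a \<gamma> * b \<gamma>) else 0)"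
      by simp
    also have "\<dots> = (if k = l then (2 * pi * \<i>) ^ CARD('d) * (\<Sum>\<gamma>\<in>layer k. a \<gamma> * b \<gamma>) else 0)"
      by (auto simp: sum_distrib_left layer_def intro!: sum.neutral)
    finally show ?thesis .
  qed
  have "torus_integral r (\<lambda>z. (\<Sum>k. \<Sum>\<gamma>\<in>layer k. a \<gamma> * chi z \<gamma>) *
                               (\<Sum>l. \<Sum>\<delta>\<in>layer l. b \<delta> * chi_star z \<delta>)) =
      (\<integral>\<theta>. (\<Sum>k. u k \<theta>) * (\<Sum>l. v l \<theta>) \<partial>Q)"
    unfolding integral_Q sum_v[symmetric] by (simp add: u_def mult.assoc)
  also have "\<dots> = (\<Sum>k. \<Sum>l. \<integral>\<theta>. u k \<theta> * v l \<theta> \<partial>Q)"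
  proof (rule integral_mult_series[OF _ _ norm_u a norm_v summable_mult2[OF b]])
    show "u k \<in> borel_measurable Q" for k
      unfolding u_def by (intro meas continuous_intros cont_chi)
    show "v l \<in> borel_measurable Q" for l
      unfolding v_def sum_distrib_right mult.assoc by (intro meas continuous_intros cont_star)
  qed
  also have "\<dots> = (\<Sum>k. (2 * pi * \<i>) ^ CARD('d) * (\<Sum>\<gamma>\<in>layer k. a \<gamma> * b \<gamma>))"
  proof (rule suminf_cong)
    fix k
    \<comment> \<open>In the series over \<open>l\<close> only the term \<open>l = k\<close>
      survives.\<close>
    show "(\<Sum>l. \<integral>\<theta>. u k \<theta> * v l \<theta> \<partial>Q) = (2 * pi * \<i>) ^ CARD('d) * (\<Sum>\<gamma>\<in>layer k. a \<gamma> * b \<gamma>)"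
      unfolding uv eq_commute[of k] by (rule sums_unique[symmetric], rule sums_single)
  qed
  also have "\<dots> = (2 * pi * \<i>) ^ CARD('d) * s"
    using sums_mult[OF ab] by (rule sums_unique[symmetric])
  finally show ?thesis .
qed

section \<open>Convergence on the domains, and the pairing of the matrices\<close>

lemma layers_summable_of_summable_on:
  fixes f :: "nat ^ 'd::finite \<Rightarrow> real"
  assumes f: "f summable_on UNIV" and nonneg: "\<And>\<gamma>. 0 \<le> f \<gamma>"
  shows "summable (\<lambda>k. \<Sum>\<gamma>\<in>layer k. f \<gamma>)"
proof (rule bounded_imp_summable)
  \<comment> \<open>The layers up to \<open>n\<close> form a finite set, so a partial sum never
    exceeds the unconditional sum of the nonnegative \<open>f\<close>.\<close>
  show "(\<Sum>k\<le>n. \<Sum>\<gamma>\<in>layer k. f \<gamma>) \<le> infsum f UNIV" for n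
    unfolding sum_layers_atMost
    by (rule finite_sum_le_infsum) (use f nonneg finite_mdeg_le in auto)
qed (simp add: sum_nonneg nonneg)

lemma power_domain_summable:
  assumes "z \<in> power_domain A \<alpha>"
  shows "summable (\<lambda>k. \<Sum>\<gamma>\<in>layer k. norm (of_real (A \<alpha> \<gamma>) * chi z \<gamma>))"
  using assms interior_subset
  by (intro layers_summable_of_summable_on) (auto simp: power_domain_def)

lemma laurent_domain_summable:
  assumes "z \<in> laurent_domain A \<alpha>"
  shows "summable (\<lambda>k. \<Sum>\<gamma>\<in>layer k. norm (of_real (A \<alpha> \<gamma>) * chi_star z \<gamma>))"
  using assms interior_subset
  by (intro layers_summable_of_summable_on) (auto simp: laurent_domain_def)

text \<open>In matrix terms, \<open>(A B) (K G)\<^sup>T = (A (B G)) K\<^sup>T\<close> for symmetric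
  \<open>G\<close>. The sums from \<open>A\<close> and \<open>K\<close> are finite, so the series is
  a finite linear combination of the series for entries of \<open>B G\<close>, whose convergence is
  part of \<open>has_mmul\<close>.\<close>

lemma bilinear_pairing_sums:
  fixes A B K G X :: "'d::finite semimat"
  assumes A: "block_lower A" and K: "block_lower K"
    and X: "has_mmul B G X" and sym: "\<And>\<gamma> \<epsilon>. G \<gamma> \<epsilon> = G \<epsilon> \<gamma>"
  shows "(\<lambda>k. \<Sum>\<gamma>\<in>layer k. (A \<odot> B) \<alpha> \<gamma> * (K \<odot> G) \<beta> \<gamma>) sums
           (\<Sum>\<epsilon> | mdeg \<epsilon> \<le> mdeg \<beta>. (A \<odot> X) \<alpha> \<epsilon> * K \<beta> \<epsilon>)"
proof -
  let ?I = "{\<delta> :: nat ^ 'd. mdeg \<delta> \<le> mdeg \<alpha>}" and ?J = "{\<epsilon> :: nat ^ 'd. mdeg \<epsilon> \<le> mdeg \<beta>}"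
  have "(\<lambda>k. \<Sum>\<epsilon>\<in>?J. \<Sum>\<delta>\<in>?I. A \<alpha> \<delta> * K \<beta> \<epsilon> * (\<Sum>\<gamma>\<in>layer k. B \<delta> \<gamma> * G \<gamma> \<epsilon>)) sums
      (\<Sum>\<epsilon>\<in>?J. \<Sum>\<delta>\<in>?I. A \<alpha> \<delta> * K \<beta> \<epsilon> * X \<delta> \<epsilon>)"
    using X unfolding has_mmul_def by (intro sums_sum sums_mult) blast
  also have "(\<Sum>\<epsilon>\<in>?J. \<Sum>\<delta>\<in>?I. A \<alpha> \<delta> * K \<beta> \<epsilon> * X \<delta> \<epsilon>) = (\<Sum>\<epsilon>\<in>?J. (A \<odot> X) \<alpha> \<epsilon> * K \<beta> \<epsilon>)"
    by (simp add: block_lower_mmul_eq[OF A] sum_distrib_left mult_ac)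
  also have "(\<lambda>k. \<Sum>\<epsilon>\<in>?J. \<Sum>\<delta>\<in>?I. A \<alpha> \<delta> * K \<beta> \<epsilon> * (\<Sum>\<gamma>\<in>layer k. B \<delta> \<gamma> * G \<gamma> \<epsilon>)) =
      (\<lambda>k. \<Sum>\<gamma>\<in>layer k. (A \<odot> B) \<alpha> \<gamma> * (K \<odot> G) \<beta> \<gamma>)"
  proof
    fix k
    \<comment> \<open>Symmetry of \<open>G\<close> is used here to turn column entries into the row
      entries that occur in \<open>K \<odot> G\<close>.\<close>
    have "(\<Sum>\<epsilon>\<in>?J. \<Sum>\<delta>\<in>?I. A \<alpha> \<delta> * K \<beta> \<epsilon> * (\<Sum>\<gamma>\<in>layer k. B \<delta> \<gamma> * G \<gamma> \<epsilon>)) =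
        (\<Sum>\<epsilon>\<in>?J. \<Sum>\<gamma>\<in>layer k. \<Sum>\<delta>\<in>?I. A \<alpha> \<delta> * B \<delta> \<gamma> * (K \<beta> \<epsilon> * G \<epsilon> \<gamma>))"
      unfolding sum_distrib_left
      by (subst sum.swap[of _ "layer k"]) (intro sum.cong refl, simp add: sym mult_ac)
    also have "\<dots> = (\<Sum>\<gamma>\<in>layer k. \<Sum>\<epsilon>\<in>?J. \<Sum>\<delta>\<in>?I. A \<alpha> \<delta> * B \<delta> \<gamma> * (K \<beta> \<epsilon> * G \<epsilon> \<gamma>))"
      by (rule sum.swap)
    also have "\<dots> = (\<Sum>\<gamma>\<in>layer k. (A \<odot> B) \<alpha> \<gamma> * (K \<odot> G) \<beta> \<gamma>)"
      by (simp add: block_lower_mmul_eq[OF A] block_lower_mmul_eq[OF K]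
          sum_distrib_left sum_distrib_right)
    finally show "(\<Sum>\<epsilon>\<in>?J. \<Sum>\<delta>\<in>?I. A \<alpha> \<delta> * K \<beta> \<epsilon> * (\<Sum>\<gamma>\<in>layer k. B \<delta> \<gamma> * G \<gamma> \<epsilon>)) =
        (\<Sum>\<gamma>\<in>layer k. (A \<odot> B) \<alpha> \<gamma> * (K \<odot> G) \<beta> \<gamma>)" .
  qed
  finally show ?thesis .
qed

theorem theorem4p4p1:
  fixes N :: "'d::{finite,linorder} rmat"
    and q :: "'d rvec"
    and \<mu> :: "'d rvec measure"
    and S H :: "'d flow_times \<Rightarrow> 'd discrete_times \<Rightarrow> 'd semimat"
    and t t' :: "'d flow_times"
    and m m' :: "'d discrete_times"
    and \<alpha> \<beta> :: "'d mindex"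
    and r1 r2 :: "'d rvec"
  assumes "invertible N"
    and "\<And>a. q $ a \<noteq> 0"
    and "sets \<mu> = sets borel"
    and "\<And>\<gamma>. integrable \<mu> (\<lambda>x. mpower x \<gamma>)"
    and "msupport \<mu> \<subseteq> {x. \<forall>a. \<bar>N $ a \<bullet> x\<bar> < \<bar>q $ a\<bar>}"
    and "gauss_borel N q \<mu> t m (S t m) (H t m)"
    and "gauss_borel N q \<mu> t' m' (S t' m') (H t' m')"
    and "\<And>a. r1 $ a > 0"
    and "\<And>a. r2 $ a > 0"
    and "complex_vec r1 \<in> laurent_domain (W1_inv_transpose \<mu> (S t' m') (H t' m')) \<beta>"
    and "complex_vec r2 \<in> laurent_domain (W2 (S t m) (H t m)) \<alpha>"
    and "complex_vec r1 \<in> power_domain (W1 N q t m (S t m)) \<alpha>"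
  shows "torus_integral r1 (\<lambda>z. Psi1 N q t m (S t m) z \<alpha> * Psi1_adj \<mu> (S t' m') (H t' m') z \<beta>) =
         torus_integral r2 (\<lambda>z. Psi2 (S t m) (H t m) z \<alpha> * Psi2_adj (S t' m') (H t' m') z \<beta>)"
proof -
  let ?S = "S t m" and ?H = "H t m" and ?G = "moment_matrix \<mu>"
  \<comment> \<open>\<open>K\<close> is the coefficient matrix of \<open>Psi2_adj\<close> at the
    primed times, and \<open>K \<odot> ?G\<close> is that of \<open>Psi1_adj\<close>. The sum
    \<open>?s\<close> below is the entry \<open>(\<alpha>, \<beta>)\<close> of
    \<open>W\<^sub>2 K\<^sup>T\<close>, the common value of both pairings.\<close>
  define K where "K = minv (H t' m') \<odot> S t' m'"
  let ?s = "\<Sum>\<epsilon> | mdeg \<epsilon> \<le> mdeg \<beta>. W2 ?S ?H \<alpha> \<epsilon> * K \<beta> \<epsilon>"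
  have S: "block_unilower ?S" "block_lower ?S" and H: "block_lower ?H"
    and G: "has_mmul (W0 N q t m) ?G (minv ?S \<odot> ?H \<odot> mtranspose (minv ?S))"
    using assms(6) by (auto simp: gauss_borel_def block_unilower_def block_diag_invertible_def
        intro: block_diag_lower)
  have S': "block_lower (S t' m')" and H': "block_lower (minv (H t' m'))"
    using assms(7) block_diag_invertible_minv_lower
    by (auto simp: gauss_borel_def block_unilower_def)
  have K: "block_lower K"
    unfolding K_def by (rule block_lower_mmul[OF H' S'])
  \<comment> \<open>Multiplying the factorization by \<open>?S\<close> cancels
    \<open>minv ?S\<close>; this is the relation \<open>W\<^sub>1 G = W\<^sub>2\<close>, with
    \<open>?S\<close> applied after the infinite product \<open>W\<^sub>0 G\<close> has been
    formed.\<close>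
  have "?S \<odot> (minv ?S \<odot> ?H \<odot> mtranspose (minv ?S)) = W2 ?S ?H"
    by (simp add: W2_def S H block_unilower_minv[OF S(1)] block_lower_mmul
        flip: block_lower_mmul_assoc)
  then have pairing1: "(\<lambda>k. \<Sum>\<gamma>\<in>layer k. W1 N q t m ?S \<alpha> \<gamma> * (K \<odot> ?G) \<beta> \<gamma>) sums ?s"
    using bilinear_pairing_sums[OF S(2) K G, of \<alpha> \<beta>]
    by (simp add: moment_matrix_def W1_def mult.commute)
  \<comment> \<open>Row \<open>\<beta>\<close> of \<open>K\<close> is zero beyond degree
    \<open>mdeg \<beta>\<close>, so this series is finite.\<close>
  have pairing2: "(\<lambda>k. \<Sum>\<gamma>\<in>layer k. K \<beta> \<gamma> * W2 ?S ?H \<alpha> \<gamma>) sums ?s"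
    using layers_sums_finite[of "mdeg \<beta>" "\<lambda>\<gamma>. K \<beta> \<gamma> * W2 ?S ?H \<alpha> \<gamma>"] K
    by (simp add: block_lower_def mult.commute)
  have "torus_integral r1 (\<lambda>z. Psi1 N q t m ?S z \<alpha> * Psi1_adj \<mu> (S t' m') (H t' m') z \<beta>) =
      (2 * pi * \<i>) ^ CARD('d) * of_real ?s"
    unfolding Psi1_def Psi1_adj_def mvec_def
    using sums_of_real[OF pairing1, where 'a = complex]
    by (intro torus_integral_power_laurent assms(8) power_domain_summable[OF assms(12)]
        laurent_domain_summable[OF assms(10)]) (simp add: W1_inv_transpose_def K_def)
  \<comment> \<open>The factors are exchanged because \<open>Psi2_adj\<close> is now the power
    series and \<open>Psi2\<close> the Laurent series. As \<open>Psi2_adj\<close> is a polynomial,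
    it converges on every torus.\<close>
  also have "\<dots> = torus_integral r2 (\<lambda>z. Psi2_adj (S t' m') (H t' m') z \<beta> * Psi2 ?S ?H z \<alpha>)"
    unfolding Psi2_def Psi2_adj_def block_lower_mvec_mvec[OF H' S', folded K_def]
    unfolding mvec_def
  proof (intro torus_integral_power_laurent[symmetric] assms(9) laurent_domain_summable[OF assms(11)])
    show "summable (\<lambda>k. \<Sum>\<gamma>\<in>layer k. norm (of_real (K \<beta> \<gamma>) * chi (complex_vec r2) \<gamma>))"
      by (rule sums_summable, rule layers_sums_finite[of "mdeg \<beta>"])
        (use K in \<open>simp add: block_lower_def\<close>)
    show "(\<lambda>k. \<Sum>\<gamma>\<in>layer k. of_real (K \<beta> \<gamma>) * of_real (W2 ?S ?H \<alpha> \<gamma>)) sums complex_of_real ?s"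
      using sums_of_real[OF pairing2, where 'a = complex] by simp
  qed
  finally show ?thesis
    by (simp add: mult.commute)
qed

end
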